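(* Let $k\geq 0$ be an integer and let $G$ be a $k$-gap-planar graph. Then for every integer $r\geq 0$, $$\widetilde{\nabla}_r(G)\leq 8\sqrt{(2r+1)(k+1)}.$$
   Context: All graphs are simple, finite and undirected. A drawing of a graph $G$ in the plane represents each vertex by a distinct point and each edge $vw$ by a non-self-intersecting curve between the points of $v$ and $w$, such that no three edges cross at a single point. A drawing is $k$-gap-planar if every crossing can be charged to one of the two edges involved so that at most $k$ crossings are charged to each edge; a graph is $k$-gap-planar if it has a $k$-gap-planar drawing in the plane. The density of a graph $G$ is $|E(G)|/|V(G)|$ if $V(G)\neq\emptyset$, and $0$ otherwise. A $(\leq c)$-subdivision of a graph $H$ is a graph obtained from $H$ by replacing each edge by a path with at most $c$ internal (new) vertices, internally disjoint paths for distinct edges. A graph $H$ is an $r$-shallow topological minor of $G$ if some $(\leq 2r)$-subdivision of $H$ is a subgraph of $G$. $\widetilde{\nabla}_r(G)$ denotes the maximum density of an $r$-shallow topological minor of $G$. *)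

theory Defs
  imports "HOL-Analysis.Analysis"
begin

definition simple_graph :: "'v set \<Rightarrow> 'v set set \<Rightarrow> bool" where
  "simple_graph V E \<longleftrightarrow> finite V \<and>
     (\<forall>e\<in>E. \<exists>u v. u \<noteq> v \<and> u \<in> V \<and> v \<in> V \<and> e = {u, v})"

definition curve_interior :: "(real \<Rightarrow> complex) \<Rightarrow> complex set" where
  "curve_interior g = g ` {0<..<1}"

definition drawing ::
  "'v set \<Rightarrow> 'v set set \<Rightarrow> ('v \<Rightarrow> complex) \<Rightarrow> ('v set \<Rightarrow> real \<Rightarrow> complex) \<Rightarrow> bool" where
  "drawing V E p \<gamma> \<longleftrightarrow>
     inj_on p V \<and>
     (\<forall>e\<in>E. arc (\<gamma> e) \<and> {pathstart (\<gamma> e), pathfinish (\<gamma> e)} = p ` e \<and>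
              (\<forall>v\<in>V. p v \<notin> curve_interior (\<gamma> e))) \<and>
     (\<forall>e1\<in>E. \<forall>e2\<in>E. \<forall>e3\<in>E. e1 \<noteq> e2 \<and> e1 \<noteq> e3 \<and> e2 \<noteq> e3 \<longrightarrow>
        curve_interior (\<gamma> e1) \<inter> curve_interior (\<gamma> e2) \<inter> curve_interior (\<gamma> e3) = {})"

definition crossings ::
  "'v set set \<Rightarrow> ('v set \<Rightarrow> real \<Rightarrow> complex) \<Rightarrow> (complex \<times> 'v set set) set" where
  "crossings E \<gamma> = {(x, {e, f}) | x e f. e \<in> E \<and> f \<in> E \<and> e \<noteq> f \<and>
       x \<in> curve_interior (\<gamma> e) \<and> x \<in> curve_interior (\<gamma> f)}"

definition gap_planar_drawing ::
  "nat \<Rightarrow> 'v set \<Rightarrow> 'v set set \<Rightarrow> ('v \<Rightarrow> complex) \<Rightarrow> ('v set \<Rightarrow> real \<Rightarrow> complex) \<Rightarrow> bool" where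
  "gap_planar_drawing k V E p \<gamma> \<longleftrightarrow> drawing V E p \<gamma> \<and>
     (\<exists>ch :: complex \<times> 'v set set \<Rightarrow> 'v set.
        (\<forall>c\<in>crossings E \<gamma>. ch c \<in> snd c) \<and>
        (\<forall>e\<in>E. finite {c\<in>crossings E \<gamma>. ch c = e} \<and> card {c\<in>crossings E \<gamma>. ch c = e} \<le> k))"

definition gap_planar :: "nat \<Rightarrow> 'v set \<Rightarrow> 'v set set \<Rightarrow> bool" where
  "gap_planar k V E \<longleftrightarrow> (\<exists>p \<gamma>. gap_planar_drawing k V E p \<gamma>)"

definition density :: "'a set \<Rightarrow> 'a set set \<Rightarrow> real" where
  "density V E = (if V = {} then 0 else real (card E) / real (card V))"

definition graph_path :: "'v set \<Rightarrow> 'v set set \<Rightarrow> 'v list \<Rightarrow> bool" where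
  "graph_path V E P \<longleftrightarrow> distinct P \<and> 2 \<le> length P \<and> set P \<subseteq> V \<and>
     (\<forall>i. Suc i < length P \<longrightarrow> {P ! i, P ! Suc i} \<in> E)"

definition path_internal :: "'v list \<Rightarrow> 'v set" where
  "path_internal P = set (butlast (tl P))"

text \<open>(H_V,H_E) is an r-shallow topological minor of (V,E): some (\<le>2r)-subdivision of H is a
  subgraph of G. Branch vertices are given by the injection \<phi>, subdivided edges by paths
  with at most 2r internal vertices, internally disjoint and avoiding branch vertices.\<close>
definition shallow_top_minor ::
  "nat \<Rightarrow> 'h set \<Rightarrow> 'h set set \<Rightarrow> 'v set \<Rightarrow> 'v set set \<Rightarrow> bool" where
  "shallow_top_minor r HV HE V E \<longleftrightarrow>
     (\<exists>\<phi> P. inj_on \<phi> HV \<and> \<phi> ` HV \<subseteq> V \<and>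
        (\<forall>e\<in>HE. graph_path V E (P e) \<and> {hd (P e), last (P e)} = \<phi> ` e \<and>
                 length (P e) \<le> 2 * r + 2 \<and> path_internal (P e) \<inter> \<phi> ` HV = {}) \<and>
        (\<forall>e\<in>HE. \<forall>f\<in>HE. e \<noteq> f \<longrightarrow> path_internal (P e) \<inter> path_internal (P f) = {}))"

text \<open>\<nabla>~_r(G): the maximum density of an r-shallow topological minor of G
  (minors taken up to isomorphism, represented on vertex type nat).\<close>
definition top_grad :: "nat \<Rightarrow> 'v set \<Rightarrow> 'v set set \<Rightarrow> real" where
  "top_grad r V E = Sup {density HV HE | (HV :: nat set) HE.
       simple_graph HV HE \<and> shallow_top_minor r HV HE V E}"

end

theory Submission
  imports Defs
begin

text \<open>
  Concatenating the arcs along the paths of a shallow topological minor \<open>H\<close> with \<open>n\<close> vertices and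
  \<open>m\<close> edges draws \<open>H\<close> so that at most \<open>k (2 r + 1) m\<close> pairs of disjoint edges meet, and the
  crossing lemma turns this into \<open>m\<^sup>2 \<le> 64 k (2 r + 1) n\<^sup>2\<close>. The averaging argument needs
  \<open>m \<le> 3 n\<close> for graphs drawn so that disjoint edges do not meet. Adjacent edges may intersect
  arbitrarily in such a drawing, so Euler's formula is not available, but the class of these graphs is
  closed under contraction and does not contain \<open>K\<^sub>5\<close>, and Mader's contraction argument
  gives the bound. For \<open>K\<^sub>5\<close>, a continuous logarithm of \<open>g s - h t\<close> for each pair \<open>g\<close>, \<open>h\<close> of
  disjoint edges relates the winding of edges about vertices; adding up the relations over all 15 pairs
  contradicts parity.
\<close>

section \<open>Drawings of the complete graph on five vertices\<close>

text \<open>The change along \<open>g\<close> of a continuous branch of the logarithm of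
  \<open>g t - z\<close>; for a closed path this is \<open>2 * pi * \<i>\<close> times the winding
  number about \<open>z\<close>. If no such branch exists, for instance when \<open>g\<close> passes
  through \<open>z\<close>, the value is arbitrary.\<close>

definition log_incr :: "(real \<Rightarrow> complex) \<Rightarrow> complex \<Rightarrow> complex" where
  "log_incr g z = (SOME w. \<exists>F. continuous_on {0..1} F \<and> (\<forall>t\<in>{0..1}. g t - z = exp (F t)) \<and>
     w = F 1 - F 0)"

text \<open>Two continuous logarithms of the same function differ by a continuous function with
  values in the multiples of \<open>2 * pi * \<i>\<close>. On an interval that difference is
  constant and cancels in the increment, so any branch computes \<open>log_incr\<close>.\<close>

lemma log_incr_eq:
  assumes F: "continuous_on {0..1} F" "\<And>t. t \<in> {0..1} \<Longrightarrow> g t - z = exp (F t)"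
  shows "log_incr g z = F 1 - F 0"
proof -
  have unique: "F 1 - F 0 = G 1 - G 0"
    if G: "continuous_on {0..1} G" "\<forall>t\<in>{0..1}. g t - z = exp (G t)" for G :: "real \<Rightarrow> complex"
  proof -
    have "(\<lambda>t. F t - G t) constant_on {0..1}"
    proof (rule continuous_discrete_range_constant)
      show "continuous_on {0..1} (\<lambda>t. F t - G t)"
        by (intro continuous_intros F G)
      fix s :: real assume s: "s \<in> {0..1}"
      show "\<exists>e>0. \<forall>t. t \<in> {0..1} \<and> F t - G t \<noteq> F s - G s \<longrightarrow>
              e \<le> norm (F t - G t - (F s - G s))"
      \<comment> \<open>Distinct integer multiples of \<open>2 * pi * \<i>\<close> are at least
        \<open>2 * pi\<close> apart.\<close>
      proof (intro exI[of _ "2 * pi"] conjI allI impI)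
        fix t assume t: "t \<in> {0..1} \<and> F t - G t \<noteq> F s - G s"
        have "exp (F t - G t) = 1" "exp (F s - G s) = 1"
          using F(2)[of t] G(2) F(2)[of s] s t by (auto simp: exp_diff)
        then obtain m n :: int where
          "F t - G t = of_int (2 * m) * pi * \<i>" "F s - G s = of_int (2 * n) * pi * \<i>"
          using exp_eq[of _ 0] by (metis add_0 exp_zero)
        moreover from this have "m \<noteq> n" using t by auto
        ultimately have "norm (F t - G t - (F s - G s)) = norm (of_int (m - n) * (2 * pi * \<i>))"
          by (simp add: algebra_simps)
        also have "\<dots> = \<bar>of_int (m - n)\<bar> * (2 * pi)"
          by (simp add: norm_mult del: of_int_diff)
        finally have eq: "norm (F t - G t - (F s - G s)) = \<bar>of_int (m - n)\<bar> * (2 * pi)" .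
        have "1 \<le> \<bar>m - n\<bar>" using \<open>m \<noteq> n\<close> by linarith
        then have "1 \<le> \<bar>of_int (m - n) :: real\<bar>" by linarith
        then show "2 * pi \<le> norm (F t - G t - (F s - G s))"
          unfolding eq using mult_right_mono[of 1 "\<bar>of_int (m - n) :: real\<bar>" "2 * pi"] by simp
      qed simp
    qed simp
    then have "F 1 - G 1 = F 0 - G 0"
      by (auto simp: constant_on_def)
    then show ?thesis by (simp add: algebra_simps)
  qed
  show ?thesis
    unfolding log_incr_def
  proof (rule some_equality)
    show "\<exists>G. continuous_on {0..1} G \<and> (\<forall>t\<in>{0..1}. g t - z = exp (G t)) \<and> F 1 - F 0 = G 1 - G 0"
      using F by blast
  qed (use unique in force)
qed

text \<open>A branch exists because the interval is contractible and \<open>z\<close> is off the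
  path. The end points then determine the increment up to multiples of
  \<open>2 * pi * \<i>\<close>.\<close>

lemma exp_log_incr:
  assumes "path g" "z \<notin> path_image g"
  shows "exp (log_incr g z) = (pathfinish g - z) / (pathstart g - z)"
proof -
  have "continuous_on {0..1} (\<lambda>t. g t - z)"
    using assms(1) by (auto simp: path_def intro!: continuous_intros)
  moreover have "g t - z \<noteq> 0" if "t \<in> {0..1}" for t
    using assms(2) that by (auto simp: path_image_def)
  ultimately obtain F where F: "continuous_on {0..1} F" "\<And>t. t \<in> {0..1} \<Longrightarrow> g t - z = exp (F t)"
    using continuous_logarithm_on_contractible[of "{0..1}" "\<lambda>t. g t - z"]
    by (metis convex_imp_contractible convex_real_interval(5))
  show ?thesis
    using log_incr_eq[OF F] F(2)[of 0] F(2)[of 1]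
    by (simp add: exp_diff pathfinish_def pathstart_def)
qed

text \<open>A continuous logarithm of \<open>g s - h t\<close> on the unit square has increment \<open>0\<close> along its boundary.\<close>

lemma log_incr_disjoint_paths:
  assumes "path g" "path h" "path_image g \<inter> path_image h = {}"
  shows "log_incr g (pathstart h) + log_incr h (pathfinish g) =
         log_incr g (pathfinish h) + log_incr h (pathstart g)"
proof -
  let ?Q = "{0..1} \<times> {0..1} :: (real \<times> real) set"
  have cont: "continuous_on ?Q (\<lambda>x. g (fst x) - h (snd x))"
  proof (intro continuous_on_diff)
    show "continuous_on ?Q (\<lambda>x. g (fst x))"
      using assms(1) unfolding path_def
      by (rule continuous_on_compose2) (auto intro: continuous_on_fst continuous_on_id)
    show "continuous_on ?Q (\<lambda>x. h (snd x))"
      using assms(2) unfolding path_def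
      by (rule continuous_on_compose2) (auto intro: continuous_on_snd continuous_on_id)
  qed
  have nz: "g (fst x) - h (snd x) \<noteq> 0" if "x \<in> ?Q" for x
    using assms(3) that by (auto simp: path_image_def)
  have contr: "contractible ?Q"
    by (intro convex_imp_contractible convex_Times) auto
  obtain F where F: "continuous_on ?Q F" "\<And>x. x \<in> ?Q \<Longrightarrow> g (fst x) - h (snd x) = exp (F x)"
    using continuous_logarithm_on_contractible[OF cont contr nz] by blast
  have g: "log_incr g (h t) = F (1, t) - F (0, t)" if "t \<in> {0..1}" for t
  proof (rule log_incr_eq[of "\<lambda>s. F (s, t)"])
    show "continuous_on {0..1} (\<lambda>s. F (s, t))"
      using that by (intro continuous_on_compose2[OF F(1), of _ "\<lambda>s. (s, t)"] continuous_on_Pair) auto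
  qed (use F(2) that in force)
  have h: "log_incr h (g s) = F (s, 1) - F (s, 0)" if "s \<in> {0..1}" for s
  proof -
    \<comment> \<open>The shift by \<open>pi * \<i>\<close> turns a logarithm of
      \<open>g s - h t\<close> into one of \<open>h t - g s\<close>; it cancels in the
      increment.\<close>
    have "log_incr h (g s) = (F (s, 1) + pi * \<i>) - (F (s, 0) + pi * \<i>)"
    proof (rule log_incr_eq[of "\<lambda>t. F (s, t) + pi * \<i>"])
      show "continuous_on {0..1} (\<lambda>t. F (s, t) + pi * \<i>)"
        using that by (intro continuous_on_add continuous_on_compose2[OF F(1), of _ "Pair s"] continuous_on_Pair) auto
      fix t :: real assume "t \<in> {0..1}"
      then have "g s - h t = exp (F (s, t))" using F(2)[of "(s, t)"] that by simp
      then show "h t - g s = exp (F (s, t) + pi * \<i>)" by (simp add: exp_add algebra_simps)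
    qed
    then show ?thesis by simp
  qed
  show ?thesis
    by (simp add: pathstart_def pathfinish_def g h)
qed

text \<open>Modulo \<open>2 * pi * \<i>\<close> every increment is determined by fixed logarithms
  \<open>A i j\<close> of the differences \<open>b i - b j\<close>; the integers
  \<open>n i j k\<close> record the remaining full turns. Each pair of disjoint edges gives one
  linear relation between these integers, and the relations together are inconsistent modulo
  2.\<close>

lemma K5_paths_meet:
  fixes b :: "nat \<Rightarrow> complex" and g :: "nat \<Rightarrow> nat \<Rightarrow> real \<Rightarrow> complex"
  assumes path: "\<And>i j. i < j \<Longrightarrow> j < 5 \<Longrightarrow>
      path (g i j) \<and> pathstart (g i j) = b i \<and> pathfinish (g i j) = b j"
  assumes disj: "\<And>i j k l. i < j \<Longrightarrow> j < 5 \<Longrightarrow> k < l \<Longrightarrow> l < 5 \<Longrightarrow> {i, j} \<inter> {k, l} = {} \<Longrightarrow>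
      path_image (g i j) \<inter> path_image (g k l) = {}"
  shows False
proof -
  have fresh: "\<exists>l<5. l \<noteq> i \<and> l \<noteq> j \<and> l \<noteq> k" for i j k :: nat
  proof (rule ccontr)
    assume "\<not> ?thesis"
    then have "{..<5} \<subseteq> {i, j, k}" by auto
    then have "card {..<5::nat} \<le> card {i, j, k}" by (intro card_mono) auto
    also have "\<dots> \<le> 3" by (simp add: card_insert_if)
    finally show False by simp
  qed
  have ends: "b i \<in> path_image (g (min i j) (max i j))" if "i < 5" "j < 5" "i \<noteq> j" for i j
    using path[of i j] path[of j i] that pathstart_in_path_image[of "g i j"]
      pathfinish_in_path_image[of "g j i"]
    by (cases "i < j") (auto simp: min_def max_def)
  \<comment> \<open>With five vertices there is an edge from \<open>k\<close> that is disjoint from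
    \<open>ij\<close>; it contains \<open>b k\<close>, so the edge \<open>ij\<close> cannot.\<close>
  have avoid: "b k \<notin> path_image (g i j)" if "i < j" "j < 5" "k < 5" "k \<noteq> i" "k \<noteq> j" for i j k
  proof -
    obtain l where l: "l < 5" "l \<noteq> i" "l \<noteq> j" "l \<noteq> k" using fresh by blast
    have "path_image (g i j) \<inter> path_image (g (min k l) (max k l)) = {}"
      using that l by (intro disj) (auto simp: min_def max_def)
    then show ?thesis using ends[of k l] that l by blast
  qed
  \<comment> \<open>The edge joining \<open>i\<close> to a third vertex contains \<open>b i\<close>
    but, by \<open>avoid\<close>, not \<open>b j\<close>.\<close>
  have inj: "b i \<noteq> b j" if "i < j" "j < 5" for i j
  proof -
    obtain l where l: "l < 5" "l \<noteq> i" "l \<noteq> j" using fresh by blast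
    have "b j \<notin> path_image (g (min i l) (max i l))"
      using that l by (intro avoid) (auto simp: min_def max_def)
    then show ?thesis using ends[of i l] that l by auto
  qed
  \<comment> \<open>One logarithm is chosen per unordered pair, so that reversing the pair changes
    it by exactly \<open>pi * \<i>\<close> up to sign. These half turns produce the parity
    defect.\<close>
  define A where "A i j = (if i < j then Ln (b i - b j) else Ln (b j - b i) + pi * \<i>)" for i j
  have expA: "exp (A i j) = b i - b j" if "i < 5" "j < 5" "i \<noteq> j" for i j
    using inj[of i j] inj[of j i] that by (auto simp: A_def exp_add exp_Ln)
  have "\<exists>n::int. log_incr (g i j) (b k) = A j k - A i k + of_int n * (2 * pi * \<i>)"
    if "i < j" "j < 5" "k < 5" "k \<noteq> i" "k \<noteq> j" for i j k
  proof -
    have "exp (log_incr (g i j) (b k)) = exp (A j k - A i k)"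
      using exp_log_incr[of "g i j" "b k"] path[of i j] avoid[of i j k] expA[of j k] expA[of i k] that
      by (simp add: exp_diff)
    then obtain n :: int where "log_incr (g i j) (b k) = A j k - A i k + (of_int (2 * n) * pi) * \<i>"
      unfolding exp_eq by blast
    then show ?thesis by (intro exI[of _ n]) (simp add: algebra_simps)
  qed
  then obtain n :: "nat \<Rightarrow> nat \<Rightarrow> nat \<Rightarrow> int" where
    n: "\<And>i j k. i < j \<Longrightarrow> j < 5 \<Longrightarrow> k < 5 \<Longrightarrow> k \<noteq> i \<Longrightarrow> k \<noteq> j \<Longrightarrow>
      log_incr (g i j) (b k) = A j k - A i k + of_int (n i j k) * (2 * pi * \<i>)"
    by metis
  have square: "log_incr (g i j) (b k) + log_incr (g k l) (b j) = log_incr (g i j) (b l) + log_incr (g k l) (b i)"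
    if "i < j" "j < 5" "k < l" "l < 5" "{i, j} \<inter> {k, l} = {}" for i j k l
    using log_incr_disjoint_paths[of "g i j" "g k l"] path[of i j] path[of k l] disj[of i j k l] that by simp
  define \<epsilon> :: "nat \<Rightarrow> nat \<Rightarrow> int" where "\<epsilon> i j = (if i < j then 1 else 0)" for i j
  have flip: "A i j = A j i + (1 - 2 * of_int (\<epsilon> i j)) * (pi * \<i>)" if "i \<noteq> j" for i j
    using that by (auto simp: A_def \<epsilon>_def)
  \<comment> \<open>In the relation \<open>square\<close> the logarithms cancel up to four reversals
    \<open>A i k - A k i\<close> and the like. Each is plus or minus half a turn, with the sign
    given by \<open>\<epsilon>\<close>.\<close>
  have parity: "n i j k + n k l j - n i j l - n k l i = \<epsilon> j k + \<epsilon> k i + \<epsilon> l j + \<epsilon> i l - 2"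
    if "i < j" "j < 5" "k < l" "l < 5" "{i, j} \<inter> {k, l} = {}" for i j k l
  proof -
    have "of_int (n i j k + n k l j - n i j l - n k l i) * (2 * pi * \<i>)
        = A i k - A j k + A k j - A l j + A j l - A i l + A l i - A k i"
    proof -
      note square[OF that]
      moreover have "log_incr (g i j) (b k) = A j k - A i k + of_int (n i j k) * (2 * pi * \<i>)"
        "log_incr (g k l) (b j) = A l j - A k j + of_int (n k l j) * (2 * pi * \<i>)"
        "log_incr (g i j) (b l) = A j l - A i l + of_int (n i j l) * (2 * pi * \<i>)"
        "log_incr (g k l) (b i) = A l i - A k i + of_int (n k l i) * (2 * pi * \<i>)"
        by (intro n; use that in auto)+
      ultimately show ?thesis
        unfolding of_int_add of_int_diff by algebra
    qed
    also have "\<dots> = of_int (\<epsilon> j k + \<epsilon> k i + \<epsilon> l j + \<epsilon> i l - 2) * (2 * pi * \<i>)"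
    proof -
      have "A j k = A k j + (1 - 2 * of_int (\<epsilon> j k)) * (pi * \<i>)"
        "A k i = A i k + (1 - 2 * of_int (\<epsilon> k i)) * (pi * \<i>)"
        "A l j = A j l + (1 - 2 * of_int (\<epsilon> l j)) * (pi * \<i>)"
        "A i l = A l i + (1 - 2 * of_int (\<epsilon> i l)) * (pi * \<i>)"
        by (intro flip; use that in auto)+
      then show ?thesis
        unfolding of_int_add of_int_diff of_int_numeral of_real_mult of_real_numeral by algebra
    qed
    finally have "of_int (n i j k + n k l j - n i j l - n k l i) = (of_int (\<epsilon> j k + \<epsilon> k i + \<epsilon> l j + \<epsilon> i l - 2) :: complex)"
      by (simp del: of_int_diff of_int_add)
    then show ?thesis by (simp only: of_int_eq_iff)
  qed
  txt \<open>The right-hand side of \<open>parity\<close> is odd exactly if the chords \<open>ij\<close> and \<open>kl\<close> of a convex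
    pentagon cross, which happens for 5 of the 15 pairs, whereas each \<open>n i j k\<close> occurs in two of the
    15 relations.\<close>
  note p = parity[unfolded \<epsilon>_def]
  have "2 * (n 0 1 2 - n 0 1 4 + n 0 2 1 - n 0 2 4 + n 0 3 1 - n 0 3 4 + n 0 4 1 - n 0 4 3
      - n 1 2 0 + n 1 2 3 - n 1 3 0 + n 1 3 2 - n 1 4 0 + n 1 4 2
      - n 2 3 0 + n 2 3 4 - n 2 4 0 + n 2 4 3 - n 3 4 0 + n 3 4 2) = - 5"
    using p[of 0 1 2 3] p[of 0 2 1 3] p[of 0 3 1 2]
      p[of 0 1 2 4] p[of 0 2 1 4] p[of 0 4 1 2]
      p[of 0 1 3 4] p[of 0 3 1 4] p[of 0 4 1 3]
      p[of 0 2 3 4] p[of 0 3 2 4] p[of 0 4 2 3]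
      p[of 1 2 3 4] p[of 1 3 2 4] p[of 1 4 2 3]
    by simp
  then show False by presburger
qed

section \<open>Graphs whose disjoint edges can be drawn disjointly\<close>

text \<open>Edges are represented by path-connected sets instead of arcs, so that a contracted or
  subdivided edge can simply be the union of the curves it runs through.\<close>

definition almost_embedding :: "'a set set \<Rightarrow> ('a \<Rightarrow> complex) \<Rightarrow> ('a set \<Rightarrow> complex set) \<Rightarrow> bool" where
  "almost_embedding E b S \<longleftrightarrow> (\<forall>e\<in>E. path_connected (S e) \<and> b ` e \<subseteq> S e) \<and>
     (\<forall>e\<in>E. \<forall>f\<in>E. e \<inter> f = {} \<longrightarrow> S e \<inter> S f = {})"

text \<open>There is no condition on edges sharing a vertex; this is what makes the class closed under
  contraction, where an edge \<open>vw\<close> is rerouted through \<open>uv\<close>.\<close>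

definition almost_planar :: "'a set set \<Rightarrow> bool" where
  "almost_planar E \<longleftrightarrow> (\<exists>b S. almost_embedding E b S)"

lemma almost_planar_subset: "almost_planar E \<Longrightarrow> F \<subseteq> E \<Longrightarrow> almost_planar F"
  unfolding almost_planar_def almost_embedding_def by (meson subsetD)

text \<open>Paths chosen inside the sets of the ten edges would form the family excluded by
  \<open>K5_paths_meet\<close>; distinctness of \<open>a\<close> turns disjoint index pairs into
  disjoint edges.\<close>

lemma clique_list_not_almost_planar:
  assumes "distinct a" "length a = 5" "\<And>i j. i < j \<Longrightarrow> j < 5 \<Longrightarrow> {a ! i, a ! j} \<in> E"
  shows "\<not> almost_planar E"
proof
  assume "almost_planar E"
  then obtain b S where "almost_embedding E b S"
    unfolding almost_planar_def by blast
  then have S: "\<And>e. e \<in> E \<Longrightarrow> path_connected (S e) \<and> b ` e \<subseteq> S e"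
    and disj: "\<And>e f. e \<in> E \<Longrightarrow> f \<in> E \<Longrightarrow> e \<inter> f = {} \<Longrightarrow> S e \<inter> S f = {}"
    by (simp_all add: almost_embedding_def)
  have "\<exists>g. path g \<and> path_image g \<subseteq> S {a ! i, a ! j} \<and> pathstart g = b (a ! i) \<and> pathfinish g = b (a ! j)"
    if "i < j" "j < 5" for i j
    using S[OF assms(3)[OF that]] unfolding path_connected_def by auto
  then obtain g where g: "\<And>i j. i < j \<Longrightarrow> j < 5 \<Longrightarrow> path (g i j) \<and> path_image (g i j) \<subseteq> S {a ! i, a ! j} \<and>
      pathstart (g i j) = b (a ! i) \<and> pathfinish (g i j) = b (a ! j)"
    by metis
  show False
  proof (rule K5_paths_meet[of g "\<lambda>i. b (a ! i)"])
    fix i j k l :: nat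
    assume ij: "i < j" "j < 5" and kl: "k < l" "l < 5" and "{i, j} \<inter> {k, l} = {}"
    then have "{a ! i, a ! j} \<inter> {a ! k, a ! l} = {}"
      using assms(1,2) by (auto simp: nth_eq_iff_index_eq)
    then have "S {a ! i, a ! j} \<inter> S {a ! k, a ! l} = {}"
      using assms(3) ij kl by (intro disj) auto
    then show "path_image (g i j) \<inter> path_image (g k l) = {}"
      using g[OF ij] g[OF kl] by blast
  qed (use g in blast)
qed

lemma five_clique_not_almost_planar:
  assumes "distinct [v, w, x, y, z]"
    and "{v, w} \<in> E" "{v, x} \<in> E" "{v, y} \<in> E" "{v, z} \<in> E" "{w, x} \<in> E" "{w, y} \<in> E" "{w, z} \<in> E"
      "{x, y} \<in> E" "{x, z} \<in> E" "{y, z} \<in> E"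
  shows "\<not> almost_planar E"
proof (rule clique_list_not_almost_planar[OF assms(1)])
  fix i j :: nat assume "i < j" "j < 5"
  then have "i \<in> {0,1,2,3}" "j \<in> {1,2,3,4}" by auto
  then show "{[v, w, x, y, z] ! i, [v, w, x, y, z] ! j} \<in> E"
    using \<open>i < j\<close> assms by (elim insertE) auto
qed simp

section \<open>Edge contraction\<close>

definition nbrs :: "'a set set \<Rightarrow> 'a \<Rightarrow> 'a set" where
  "nbrs E v = {w. {v, w} \<in> E}"

text \<open>The vertex \<open>v\<close> is merged into \<open>u\<close>. The loop arising from
  \<open>uv\<close> is dropped, and the parallel edges arising from a common neighbour coincide as
  sets.\<close>

definition contract :: "'a \<Rightarrow> 'a \<Rightarrow> 'a set set \<Rightarrow> 'a set set" where
  "contract u v E = {e \<in> E. v \<notin> e} \<union> (\<lambda>w. {u, w}) ` (nbrs E v - {u})"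

text \<open>A rerouted edge \<open>uw\<close> is the union of the sets of \<open>uv\<close> and
  \<open>vw\<close>, which share the point of \<open>v\<close>. Any edge disjoint from it avoids
  \<open>u\<close> and \<open>v\<close>, hence is an old edge disjoint from both \<open>uv\<close>
  and \<open>vw\<close>.\<close>

lemma almost_planar_contract:
  assumes "almost_planar E" and uv: "{u, v} \<in> E" "u \<noteq> v" and loopfree: "{v} \<notin> E"
  shows "almost_planar (contract u v E)"
proof -
  obtain b S where "almost_embedding E b S"
    using assms(1) unfolding almost_planar_def by blast
  then have S: "\<And>e. e \<in> E \<Longrightarrow> path_connected (S e) \<and> b ` e \<subseteq> S e"
    and disj: "\<And>e f. e \<in> E \<Longrightarrow> f \<in> E \<Longrightarrow> e \<inter> f = {} \<Longrightarrow> S e \<inter> S f = {}"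
    by (simp_all add: almost_embedding_def)
  \<comment> \<open>Edges of \<open>E\<close> keep their set. For a new edge \<open>e\<close>, equal
    to \<open>uw\<close>, the term \<open>insert v (e - {u})\<close> recovers
    \<open>vw\<close>.\<close>
  define S' where "S' e = (if e \<in> E then S e else S {u, v} \<union> S (insert v (e - {u})))" for e
  have cases: "(e \<in> E \<and> v \<notin> e \<and> S' e = S e) \<or>
      (\<exists>w. e = {u, w} \<and> w \<noteq> u \<and> w \<noteq> v \<and> {v, w} \<in> E \<and> S' e = S {u, v} \<union> S {v, w})"
    if e: "e \<in> contract u v E" for e
  proof (cases "e \<in> E \<and> v \<notin> e")
    case False
    then obtain w where w: "e = {u, w}" "w \<noteq> u" "{v, w} \<in> E"
      using e unfolding contract_def nbrs_def by auto
    then have "w \<noteq> v" using loopfree by auto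
    then have "e \<notin> E" using False w uv by auto
    moreover have "insert v (e - {u}) = {v, w}" using w by auto
    ultimately show ?thesis using w \<open>w \<noteq> v\<close> by (auto simp: S'_def)
  qed (simp add: S'_def)
  show ?thesis
    unfolding almost_planar_def almost_embedding_def
  proof (intro exI conjI ballI impI)
    fix e assume e: "e \<in> contract u v E"
    from cases[OF e] show "path_connected (S' e)"
    proof (elim disjE exE conjE)
      fix w assume w: "e = {u, w}" "{v, w} \<in> E" "S' e = S {u, v} \<union> S {v, w}"
      show ?thesis
        unfolding w(3) using S[OF uv(1)] S[OF w(2)] by (intro path_connected_Un) auto
    qed (use S in auto)
    from cases[OF e] show "b ` e \<subseteq> S' e"
    proof (elim disjE exE conjE)
      fix w assume w: "e = {u, w}" "{v, w} \<in> E" "S' e = S {u, v} \<union> S {v, w}"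
      show ?thesis
        unfolding w(3) using S[OF uv(1)] S[OF w(2)] w(1) by auto
    qed (use S in auto)
  next
    fix e f assume ef: "e \<in> contract u v E" "f \<in> contract u v E" "e \<inter> f = {}"
    show "S' e \<inter> S' f = {}"
      using cases[OF ef(1)]
    proof (elim disjE exE conjE)
      assume e: "e \<in> E" "v \<notin> e" "S' e = S e"
      show ?thesis
        using cases[OF ef(2)]
      proof (elim disjE exE conjE)
        assume f: "f \<in> E" "S' f = S f"
        then show ?thesis using disj e ef(3) by auto
      next
        fix w assume w: "f = {u, w}" "{v, w} \<in> E" "S' f = S {u, v} \<union> S {v, w}"
        have "e \<inter> {u, v} = {}" "e \<inter> {v, w} = {}"
          using e(2) w(1) ef(3) by auto
        then have "S e \<inter> S {u, v} = {}" "S e \<inter> S {v, w} = {}"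
          by (simp_all only: disj[OF e(1) uv(1)] disj[OF e(1) w(2)])
        then show ?thesis unfolding e(3) w(3) by blast
      qed
    next
      fix w assume w: "e = {u, w}" "{v, w} \<in> E" "S' e = S {u, v} \<union> S {v, w}"
      \<comment> \<open>Two rerouted edges share \<open>u\<close>, so \<open>f\<close> must be an
        old edge.\<close>
      then have f: "f \<in> E" "v \<notin> f" "S' f = S f"
        using cases[OF ef(2)] ef(3) by auto
      have "{u, v} \<inter> f = {}" "{v, w} \<inter> f = {}"
        using f(2) w(1) ef(3) by auto
      then have "S {u, v} \<inter> S f = {}" "S {v, w} \<inter> S f = {}"
        by (simp_all only: disj[OF uv(1) f(1)] disj[OF w(2) f(1)])
      then show ?thesis unfolding f(3) w(3) by blast
    qed
  qed
qed

section \<open>Edge counts under deletion and contraction\<close>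

lemma simple_graphD:
  assumes "simple_graph V E"
  shows "finite V" "finite E" "e \<in> E \<Longrightarrow> card e = 2" "e \<in> E \<Longrightarrow> e \<subseteq> V"
    "{u, v} \<in> E \<Longrightarrow> u \<noteq> v \<and> u \<in> V \<and> v \<in> V"
proof -
  show "finite V" using assms by (simp add: simple_graph_def)
  have "E \<subseteq> Pow V" using assms by (auto simp: simple_graph_def)
  then show "finite E" using \<open>finite V\<close> by (meson finite_Pow_iff finite_subset)
  show "card e = 2" if "e \<in> E" for e
    using assms that by (auto simp: simple_graph_def)
  show "e \<subseteq> V" if "e \<in> E" for e
    using \<open>E \<subseteq> Pow V\<close> that by auto
  show "u \<noteq> v \<and> u \<in> V \<and> v \<in> V" if "{u, v} \<in> E" for u v
    using assms that unfolding simple_graph_def by (metis doubleton_eq_iff)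
qed

lemma card_incident_edges:
  assumes "simple_graph V E"
  shows "card {e \<in> E. v \<in> e} = card (nbrs E v)"
proof (rule bij_betw_same_card[symmetric])
  show "bij_betw (\<lambda>w. {v, w}) (nbrs E v) {e \<in> E. v \<in> e}"
  proof (rule bij_betw_imageI)
    show "inj_on (\<lambda>w. {v, w}) (nbrs E v)"
      by (auto simp: inj_on_def doubleton_eq_iff)
    show "(\<lambda>w. {v, w}) ` nbrs E v = {e \<in> E. v \<in> e}"
    proof (intro equalityI subsetI)
      fix e assume e: "e \<in> {e \<in> E. v \<in> e}"
      then obtain x y where "e = {x, y}" using assms unfolding simple_graph_def by blast
      then obtain w where "e = {v, w}" using e by auto
      then show "e \<in> (\<lambda>w. {v, w}) ` nbrs E v" using e by (auto simp: nbrs_def)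
    qed (auto simp: nbrs_def)
  qed
qed

lemma simple_graph_delete:
  assumes "simple_graph V E"
  shows "simple_graph (V - {v}) {e \<in> E. v \<notin> e}"
    "card E = card {e \<in> E. v \<notin> e} + card (nbrs E v)"
proof -
  show "simple_graph (V - {v}) {e \<in> E. v \<notin> e}"
    using assms unfolding simple_graph_def by fastforce
  have "card E = card ({e \<in> E. v \<notin> e} \<union> {e \<in> E. v \<in> e})"
    by (rule arg_cong[where f = card]) auto
  also have "\<dots> = card {e \<in> E. v \<notin> e} + card {e \<in> E. v \<in> e}"
    using simple_graphD(2)[OF assms] by (intro card_Un_disjoint) auto
  finally show "card E = card {e \<in> E. v \<notin> e} + card (nbrs E v)"
    by (simp add: card_incident_edges[OF assms])
qed

text \<open>Contraction loses the edge \<open>uv\<close> and, for each common neighbour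
  \<open>w\<close>, one of the two edges \<open>uw\<close> and \<open>vw\<close> that become equal.
  A bound on the edges lost is thus a bound on the triangles through \<open>uv\<close>.\<close>

lemma simple_graph_contract:
  assumes "simple_graph V E" "{u, v} \<in> E"
  shows "simple_graph (V - {v}) (contract u v E)"
    "card E = card (contract u v E) + 1 + card (nbrs E u \<inter> nbrs E v)"
proof -
  note D = simple_graphD[OF assms(1)]
  have nb: "finite (nbrs E x)" for x
    using D(1,5) unfolding nbrs_def by (rule_tac finite_subset[of _ V]) auto
  show "simple_graph (V - {v}) (contract u v E)"
    unfolding simple_graph_def
  proof (intro conjI ballI)
    fix e assume "e \<in> contract u v E"
    then show "\<exists>x y. x \<noteq> y \<and> x \<in> V - {v} \<and> y \<in> V - {v} \<and> e = {x, y}"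
      unfolding contract_def
    proof
      assume "e \<in> {e \<in> E. v \<notin> e}"
      then show ?thesis using assms(1) unfolding simple_graph_def by fastforce
    next
      assume "e \<in> (\<lambda>w. {u, w}) ` (nbrs E v - {u})"
      then obtain w where "e = {u, w}" "{v, w} \<in> E" "w \<noteq> u" by (auto simp: nbrs_def)
      then show ?thesis using D(5)[of v w] D(5)[OF assms(2)] by auto
    qed
  qed (use D(1) in simp)
  \<comment> \<open>The neighbours of \<open>v\<close> whose edge survives as a new edge at
    \<open>u\<close>.\<close>
  define N where "N = nbrs E v - nbrs E u - {u}"
  have "contract u v E = {e \<in> E. v \<notin> e} \<union> (\<lambda>w. {u, w}) ` N"
    using D(5)[of v v] D(5)[of u v] assms(2) by (auto simp: contract_def N_def nbrs_def)
  moreover have "{e \<in> E. v \<notin> e} \<inter> (\<lambda>w. {u, w}) ` N = {}"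
    by (auto simp: N_def nbrs_def)
  moreover have "card ((\<lambda>w. {u, w}) ` N) = card N"
    by (intro card_image) (auto simp: inj_on_def doubleton_eq_iff)
  ultimately have "card (contract u v E) = card {e \<in> E. v \<notin> e} + card N"
    using nb D(2) by (simp add: card_Un_disjoint N_def)
  moreover have "card (nbrs E v) = card N + card (insert u (nbrs E u \<inter> nbrs E v))"
  proof -
    have "nbrs E v = N \<union> insert u (nbrs E u \<inter> nbrs E v)"
      using assms(2) by (auto simp: N_def nbrs_def insert_commute)
    also have "card \<dots> = card N + card (insert u (nbrs E u \<inter> nbrs E v))"
      using nb by (intro card_Un_disjoint) (auto simp: N_def)
    finally show ?thesis .
  qed
  moreover have "card (insert u (nbrs E u \<inter> nbrs E v)) = Suc (card (nbrs E u \<inter> nbrs E v))"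
    using nb D(5)[of u u] by (intro card_insert_disjoint) (auto simp: nbrs_def)
  ultimately show "card E = card (contract u v E) + 1 + card (nbrs E u \<inter> nbrs E v)"
    using simple_graph_delete(2)[OF assms(1), of v] by simp
qed

lemma sum_degrees:
  assumes "simple_graph V E"
  shows "(\<Sum>v\<in>V. card (nbrs E v)) = 2 * card E"
proof -
  have "(\<Sum>v\<in>V. card {e \<in> E. v \<in> e}) = 2 * card E"
  proof (rule sum_multicount)
    show "\<forall>e\<in>E. card {v \<in> V. v \<in> e} = 2"
    proof
      fix e assume e: "e \<in> E"
      then have "{v \<in> V. v \<in> e} = e" using simple_graphD(4)[OF assms] by auto
      then show "card {v \<in> V. v \<in> e} = 2" using simple_graphD(3)[OF assms e] by simp
    qed
  qed (use simple_graphD[OF assms] in auto)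
  then show ?thesis by (simp add: card_incident_edges[OF assms])
qed

text \<open>The neighbourhood of \<open>v\<close> is complete up to a matching, hence contains a clique on four vertices
  after contracting at most one edge.\<close>

lemma dense_neighbourhood_not_almost_planar:
  assumes G: "simple_graph V E"
    and deg: "card (nbrs E v) \<in> {4, 5}"
    and tri: "\<And>w. {v, w} \<in> E \<Longrightarrow> 3 \<le> card (nbrs E v \<inter> nbrs E w)"
  shows "\<not> almost_planar E"
proof
  assume planar: "almost_planar E"
  note D = simple_graphD[OF G]
  let ?N = "nbrs E v"
  have fin: "finite ?N" using deg by (auto intro: card_ge_0_finite)
  have v: "v \<notin> ?N" using D(5)[of v v] by (auto simp: nbrs_def)
  have comm: "{x, y} \<in> E \<longleftrightarrow> {y, x} \<in> E" for x y by (simp add: insert_commute)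
  have vN: "{v, x} \<in> E" if "x \<in> ?N" for x using that by (simp add: nbrs_def)
  \<comment> \<open>Together with its at least three neighbours in \<open>?N\<close>, the vertex
    \<open>x\<close> accounts for four vertices of \<open>?N\<close>. So it misses none if the
    degree of \<open>v\<close> is 4 and at most one if it is 5.\<close>
  have few: "card {y \<in> ?N. y \<noteq> x \<and> {x, y} \<notin> E} + 4 \<le> card ?N" if x: "x \<in> ?N" for x
  proof -
    have "x \<notin> nbrs E x" using D(5)[of x x] by (auto simp: nbrs_def)
    then have "card (insert x ({y \<in> ?N. y \<noteq> x \<and> {x, y} \<notin> E} \<union> (?N \<inter> nbrs E x))) =
        Suc (card {y \<in> ?N. y \<noteq> x \<and> {x, y} \<notin> E} + card (?N \<inter> nbrs E x))"
      using fin by (subst card_insert_disjoint) (auto intro!: card_Un_disjoint simp: nbrs_def)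
    moreover have "insert x ({y \<in> ?N. y \<noteq> x \<and> {x, y} \<notin> E} \<union> (?N \<inter> nbrs E x)) = ?N"
      using x by (auto simp: nbrs_def)
    ultimately show ?thesis using tri[of x] vN[OF x] by simp
  qed
  show False
  proof (cases "\<exists>x\<in>?N. \<exists>y\<in>?N. x \<noteq> y \<and> {x, y} \<notin> E")
    case False
    then have clique: "{x, y} \<in> E" if "x \<in> ?N" "y \<in> ?N" "x \<noteq> y" for x y using that by blast
    have "4 \<le> card ?N" using deg by auto
    then obtain M where "M \<subseteq> ?N" "card M = 4"
      by (meson obtain_subset_with_card_n)
    then obtain w x y z where M: "M = {w, x, y, z}" "distinct [w, x, y, z]"
      by (auto simp: card_Suc_eq numeral_eq_Suc)
    then have N: "w \<in> ?N" "x \<in> ?N" "y \<in> ?N" "z \<in> ?N" using \<open>M \<subseteq> ?N\<close> by auto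
    have "\<not> almost_planar E"
      by (rule five_clique_not_almost_planar[of v w x y z]) (use M N v clique vN in auto)
    then show False using planar by simp
  next
    case True
    then obtain x y where xy: "x \<in> ?N" "y \<in> ?N" "x \<noteq> y" "{x, y} \<notin> E" by blast
    have ge1: "1 \<le> card {y \<in> ?N. y \<noteq> x \<and> {x, y} \<notin> E}"
      using xy fin by (auto simp: Suc_le_eq card_gt_0_iff)
    \<comment> \<open>A missing edge excludes degree 4.\<close>
    then have five: "card ?N = 5" using few[OF xy(1)] deg by auto
    have at_most_one: "b = c" if "a \<in> ?N" "b \<in> ?N" "c \<in> ?N" "b \<noteq> a" "c \<noteq> a" "{a, b} \<notin> E" "{a, c} \<notin> E" for a b c
    proof (rule ccontr)
      assume "b \<noteq> c"
      have "card {b, c} \<le> card {y \<in> ?N. y \<noteq> a \<and> {a, y} \<notin> E}"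
        using fin that by (intro card_mono) auto
      then show False using few[OF that(1)] five \<open>b \<noteq> c\<close> by simp
    qed
    have "card (?N - {x, y}) = 3" using five xy fin by (simp add: card_Diff_subset)
    then obtain p q r where pqr: "?N - {x, y} = {p, q, r}" "distinct [p, q, r]"
      by (auto simp: card_Suc_eq numeral_eq_Suc)
    \<comment> \<open>Since \<open>p\<close> misses at most one vertex, it is adjacent to
      \<open>q\<close> or to \<open>r\<close>; the names are swapped if necessary.\<close>
    have "\<exists>p q r. ?N - {x, y} = {p, q, r} \<and> distinct [p, q, r] \<and> {p, r} \<in> E"
    proof (cases "{p, r} \<in> E")
      case False
      have "p \<in> ?N" "q \<in> ?N" "r \<in> ?N" using pqr by auto
      then have "{p, q} \<in> E" using at_most_one[of p q r] False pqr(2) by auto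
      moreover have "?N - {x, y} = {p, r, q}" using pqr(1) by (simp add: insert_commute)
      moreover have "distinct [p, r, q]" using pqr(2) by auto
      ultimately show ?thesis by blast
    qed (use pqr in blast)
    then obtain p q r where pqr: "?N - {x, y} = {p, q, r}" "distinct [p, q, r]" "{p, r} \<in> E" by blast
    have N: "p \<in> ?N" "q \<in> ?N" "r \<in> ?N" using pqr(1) by auto
    have ne: "p \<noteq> x" "p \<noteq> y" "q \<noteq> x" "q \<noteq> y" "r \<noteq> x" "r \<noteq> y" using pqr(1) by auto
    have xE: "{x, z} \<in> E" if "z \<in> {p, q, r}" for z
      using at_most_one[of x z y] xy N ne that by auto
    have yE: "{y, z} \<in> E" if "z \<in> {p, q, r}" for z
      using at_most_one[of y z x] xy N ne that comm[of x y] by auto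
    have nv: "v \<noteq> x" "v \<noteq> y" "v \<noteq> p" "v \<noteq> q" "v \<noteq> r" using v xy N by auto
    \<comment> \<open>The vertices \<open>x\<close> and \<open>y\<close> miss only each other, so
      \<open>q\<close> is adjacent to both. Contracting \<open>q\<close> into \<open>x\<close>
      creates the missing edge \<open>xy\<close> and completes the clique on \<open>v\<close>,
      \<open>x\<close>, \<open>y\<close>, \<open>p\<close>, \<open>r\<close>.\<close>
    have "almost_planar (contract x q E)"
      using planar xE[of q] ne D(5)[of q q] by (intro almost_planar_contract) auto
    moreover have "\<not> almost_planar (contract x q E)"
    proof (rule five_clique_not_almost_planar[of v x y p r])
      show "distinct [v, x, y, p, r]" using nv ne xy pqr(2) by auto
      have keep: "e \<in> contract x q E" if "e \<in> E" "q \<notin> e" for e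
        using that by (simp add: contract_def)
      show "{v, x} \<in> contract x q E" "{v, y} \<in> contract x q E" "{v, p} \<in> contract x q E" "{v, r} \<in> contract x q E"
        using vN xy N nv ne pqr(2) by (auto intro!: keep)
      show "{x, p} \<in> contract x q E" "{x, r} \<in> contract x q E"
        using xE ne pqr(2) by (auto intro!: keep)
      have "{q, y} \<in> E" using yE[of q] comm by auto
      then show "{x, y} \<in> contract x q E"
        using xy by (auto simp: contract_def nbrs_def)
      show "{y, p} \<in> contract x q E" "{y, r} \<in> contract x q E" "{p, r} \<in> contract x q E"
        using yE ne pqr by (auto intro!: keep)
    qed
    ultimately show False by simp
  qed
qed

section \<open>The linear edge bound\<close>

text \<open>In a smallest counterexample, deletion forces degree at least 4, contraction forces
  every edge into at least three triangles, and averaging yields a vertex of degree at most 5. This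
  is the excluded dense neighbourhood. The additive constant leaves room for a single vertex, where
  the induction starts.\<close>

lemma almost_planar_card_edges:
  assumes "simple_graph V E" "almost_planar E" "V \<noteq> {}"
  shows "card E + 2 \<le> 3 * card V"
  using assms
proof (induction "card V" arbitrary: V E rule: less_induct)
  case less
  note G = less.prems(1) and planar = less.prems(2)
  have "finite V" using simple_graphD[OF G] by simp
  show ?case
  proof (rule ccontr)
    assume "\<not> ?thesis"
    then have "3 * card V - 1 \<le> card E" by simp
    \<comment> \<open>Trimming to exactly one edge above the bound keeps the average degree below 6
      and makes the losses below exact.\<close>
    then obtain F where F: "F \<subseteq> E" "card F = 3 * card V - 1"
      by (meson obtain_subset_with_card_n)
    have GF: "simple_graph V F"
      using G F(1) unfolding simple_graph_def by blast
    have pF: "almost_planar F"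
      using planar F(1) by (rule almost_planar_subset)
    have pos: "1 \<le> card V" using \<open>finite V\<close> less.prems(3) by (simp add: Suc_le_eq card_gt_0_iff)
    have "card V \<noteq> 1"
    proof
      assume "card V = 1"
      then obtain a where "V = {a}" by (auto simp: card_1_singleton_iff)
      then have "F = {}" using GF unfolding simple_graph_def by auto
      then show False using F(2) pos by simp
    qed
    have smaller: "card E' + 2 \<le> 3 * (card V - 1)"
      if "simple_graph (V - {v}) E'" "almost_planar E'" "v \<in> V" for v E'
    proof -
      have "card (V - {v}) = card V - 1" using that \<open>finite V\<close> by simp
      moreover have "V - {v} \<noteq> {}" using calculation pos \<open>card V \<noteq> 1\<close> by (metis card.empty diff_is_0_eq le_antisym)
      ultimately show ?thesis using less.hyps[OF _ that(1,2)] pos by simp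
    qed
    have "\<exists>v\<in>V. card (nbrs F v) \<le> 5"
    proof (rule ccontr)
      assume "\<not> ?thesis"
      then have "(\<Sum>v\<in>V. 6) \<le> (\<Sum>v\<in>V. card (nbrs F v))" by (intro sum_mono) force
      then show False using sum_degrees[OF GF] F(2) pos by simp
    qed
    then obtain v where v: "v \<in> V" "card (nbrs F v) \<le> 5" by blast
    have "4 \<le> card (nbrs F v)"
    proof (rule ccontr)
      assume "\<not> ?thesis"
      moreover have "card {e \<in> F. v \<notin> e} + 2 \<le> 3 * (card V - 1)"
        using simple_graph_delete(1)[OF GF] almost_planar_subset[OF pF] v(1) by (intro smaller[of v]) auto
      ultimately show False using simple_graph_delete(2)[OF GF, of v] F(2) pos by linarith
    qed
    \<comment> \<open>The contracted graph has at most \<open>3 * card V - 5\<close> edges, so at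
      least four are lost: \<open>vw\<close> itself and one per common neighbour.\<close>
    moreover have "3 \<le> card (nbrs F v \<inter> nbrs F w)" if w: "{v, w} \<in> F" for w
    proof -
      have "almost_planar (contract v w F)"
        using simple_graphD(5)[OF GF w] simple_graphD(5)[OF GF, of w w]
        by (intro almost_planar_contract[OF pF w]) auto
      then have "card (contract v w F) + 2 \<le> 3 * (card V - 1)"
        using simple_graph_contract(1)[OF GF w] simple_graphD(5)[OF GF w] by (intro smaller[of w]) auto
      then show ?thesis using simple_graph_contract(2)[OF GF w] F(2) pos by linarith
    qed
    ultimately have "\<not> almost_planar F"
      using v by (intro dense_neighbourhood_not_almost_planar[OF GF, of v]) auto
    then show False using pF by simp
  qed
qed

section \<open>The crossing lemma\<close>

text \<open>If every vertex is kept independently with probability \<open>p\<close>, the summand is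
  the probability of \<open>W\<close> and the sum is that of \<open>T \<subseteq> W\<close>. Once
  \<open>T\<close> is split off, the product of the factors \<open>p + (1 - p)\<close> over
  \<open>V - T\<close> expands to the sum.\<close>

lemma sum_random_subset:
  fixes p :: real
  assumes "finite V" "T \<subseteq> V"
  shows "(\<Sum>W | W \<subseteq> V \<and> T \<subseteq> W. p ^ card W * (1 - p) ^ card (V - W)) = p ^ card T"
proof -
  have "finite T" using assms finite_subset by blast
  have "(\<Sum>W | W \<subseteq> V \<and> T \<subseteq> W. p ^ card W * (1 - p) ^ card (V - W)) =
      (\<Sum>X\<in>Pow (V - T). p ^ card T * (p ^ card X * (1 - p) ^ card (V - T - X)))"
  proof (rule sum.reindex_bij_witness[of _ "\<lambda>X. X \<union> T" "\<lambda>W. W - T"])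
    fix W assume W: "W \<in> {W. W \<subseteq> V \<and> T \<subseteq> W}"
    then have "finite W" using assms finite_subset by blast
    then have "card W = card T + card (W - T)"
      using W \<open>finite T\<close> by (simp add: card_Diff_subset card_mono)
    moreover have "V - T - (W - T) = V - W" using W by auto
    ultimately show "p ^ card T * (p ^ card (W - T) * (1 - p) ^ card (V - T - (W - T))) =
        p ^ card W * (1 - p) ^ card (V - W)" by (simp add: power_add)
  qed (use assms in auto)
  also have "\<dots> = p ^ card T * (\<Sum>X\<in>Pow (V - T). (\<Prod>x\<in>X. p) * (\<Prod>x\<in>V - T - X. 1 - p))"
    by (simp add: sum_distrib_left)
  also have "\<dots> = p ^ card T * (\<Prod>x\<in>V - T. p + (1 - p))"
    using assms by (subst prod_add) auto
  finally show ?thesis by simp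
qed

text \<open>Linearity of expectation: each object \<open>x\<close> survives exactly if its
  \<open>c\<close> supporting vertices \<open>U x\<close> do.\<close>

lemma sum_random_subset_card:
  fixes p :: real
  assumes "finite V" "finite A" "\<And>x. x \<in> A \<Longrightarrow> U x \<subseteq> V \<and> card (U x) = c"
  shows "(\<Sum>W\<in>Pow V. p ^ card W * (1 - p) ^ card (V - W) * real (card {x \<in> A. U x \<subseteq> W})) =
    p ^ c * real (card A)"
proof -
  let ?w = "\<lambda>W. p ^ card W * (1 - p) ^ card (V - W)"
  have "(\<Sum>W\<in>Pow V. ?w W * real (card {x \<in> A. U x \<subseteq> W})) =
      (\<Sum>W\<in>Pow V. \<Sum>x\<in>A. if U x \<subseteq> W then ?w W else 0)"
    using assms(2) by (intro sum.cong) (auto simp: sum.inter_filter[symmetric])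
  also have "\<dots> = (\<Sum>x\<in>A. \<Sum>W\<in>Pow V. if U x \<subseteq> W then ?w W else 0)"
    by (rule sum.swap)
  also have "\<dots> = (\<Sum>x\<in>A. \<Sum>W | W \<subseteq> V \<and> U x \<subseteq> W. ?w W)"
    using assms(1) by (simp add: sum.inter_filter[symmetric])
  also have "\<dots> = (\<Sum>x\<in>A. p ^ c)"
    using assms by (intro sum.cong) (auto simp: sum_random_subset)
  finally show ?thesis by simp
qed

section \<open>Counting meeting pairs and averaging\<close>

text \<open>The pairs counted by the independent pair crossing number: a pair counts once, however
  often its two sets meet.\<close>

definition meeting_pairs :: "'a set set \<Rightarrow> ('a set \<Rightarrow> complex set) \<Rightarrow> 'a set set set" where
  "meeting_pairs E S = {{e, f} | e f. e \<in> E \<and> f \<in> E \<and> e \<inter> f = {} \<and> S e \<inter> S f \<noteq> {}}"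

text \<open>Removing one edge from every meeting pair leaves an almost planar graph, to which the
  linear bound applies.\<close>

lemma card_edges_le_meeting_pairs:
  assumes G: "simple_graph V E"
    and S: "\<And>e. e \<in> E \<Longrightarrow> path_connected (S e) \<and> b ` e \<subseteq> S e"
  shows "card E \<le> 3 * card V + card (meeting_pairs E S)"
proof -
  let ?X = "meeting_pairs E S"
  \<comment> \<open>\<open>h\<close> selects the edge to be removed from a pair.\<close>
  define h where "h q = (SOME e. e \<in> q)" for q :: "'a set set"
  define F where "F = E - h ` ?X"
  have hq: "h q \<in> q" if "q \<in> ?X" for q
  proof -
    have "q \<noteq> {}" using that by (auto simp: meeting_pairs_def)
    then show ?thesis unfolding h_def by (simp add: some_in_eq)
  qed
  have "finite E" using simple_graphD[OF G] by simp
  have "?X \<subseteq> Pow E" by (auto simp: meeting_pairs_def)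
  then have finX: "finite ?X" using \<open>finite E\<close> by (meson finite_Pow_iff finite_subset)
  have "almost_embedding F b S"
    unfolding almost_embedding_def
  proof (intro conjI ballI impI)
    fix e f assume ef: "e \<in> F" "f \<in> F" "e \<inter> f = {}"
    show "S e \<inter> S f = {}"
    proof (rule ccontr)
      assume "S e \<inter> S f \<noteq> {}"
      then have "{e, f} \<in> ?X" using ef unfolding meeting_pairs_def F_def by blast
      then show False using hq[of "{e, f}"] ef by (auto simp: F_def)
    qed
  qed (use S F_def in auto)
  then have "almost_planar F" by (auto simp: almost_planar_def)
  moreover have "simple_graph V F" using G unfolding simple_graph_def F_def by blast
  ultimately have "card F \<le> 3 * card V"
    using almost_planar_card_edges[of V F] by (cases "V = {}") (auto simp: simple_graph_def)
  moreover have "card E \<le> card F + card (h ` ?X)"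
    using \<open>finite E\<close> unfolding F_def
    by (metis add.commute diff_card_le_card_Diff finX finite_imageI le_diff_conv)
  moreover have "card (h ` ?X) \<le> card ?X" using finX by (rule card_image_le)
  ultimately show ?thesis by linarith
qed

text \<open>The weak bound \<open>card_edges_le_meeting_pairs\<close> is averaged over random
  induced subgraphs. Vertices, edges and meeting pairs survive with probabilities \<open>p\<close>,
  \<open>p ^ 2\<close> and \<open>p ^ 4\<close>, which amplifies the linear bound to a cubic
  one.\<close>

lemma crossing_lemma:
  assumes G: "simple_graph V E"
    and S: "\<And>e. e \<in> E \<Longrightarrow> path_connected (S e) \<and> b ` e \<subseteq> S e"
    and m: "4 * card V \<le> card E"
  shows "(card E) ^ 3 \<le> 64 * (card V)\<^sup>2 * card (meeting_pairs E S)"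
proof (cases "card V = 0")
  case True
  then have "V = {}" using simple_graphD(1)[OF G] by simp
  then have "E = {}" using G by (auto simp: simple_graph_def)
  then show ?thesis by simp
next
  case False
  note D = simple_graphD[OF G]
  let ?X = "meeting_pairs E S"
  have "?X \<subseteq> Pow E" by (auto simp: meeting_pairs_def)
  then have finX: "finite ?X" using D(2) by (meson finite_Pow_iff finite_subset)
  define n m x where "n = real (card V)" and "m = real (card E)" and "x = real (card ?X)"
  have n0: "n > 0" using False by (simp add: n_def)
  have mn: "4 * n \<le> m" using assms(3) unfolding n_def m_def by linarith
  \<comment> \<open>Chosen so that \<open>p * m = 4 * n\<close>; the assumption \<open>m\<close>
    makes it a probability.\<close>
  define p where "p = 4 * n / m"
  have p: "0 < p" "p \<le> 1" using n0 mn by (auto simp: p_def)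
  let ?w = "\<lambda>W. p ^ card W * (1 - p) ^ card (V - W)"
  \<comment> \<open>The bound for the subgraph induced by \<open>W\<close>, weighted by the
    probability of \<open>W\<close>. Writing \<open>{v} \<subseteq> W\<close> brings all three
    counts into the form of \<open>sum_random_subset_card\<close>, with \<open>c\<close> equal to 2,
    1 and 4.\<close>
  have step: "?w W * real (card {e \<in> E. e \<subseteq> W}) \<le>
      3 * (?w W * real (card {v \<in> V. {v} \<subseteq> W})) + ?w W * real (card {q \<in> ?X. \<Union>q \<subseteq> W})"
    if "W \<in> Pow V" for W
  proof -
    have W: "W \<subseteq> V" using that by simp
    have sub: "simple_graph W {e \<in> E. e \<subseteq> W}"
      unfolding simple_graph_def
    proof (intro conjI ballI)
      show "finite W" using W D(1) by (rule finite_subset)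
      fix e assume e: "e \<in> {e \<in> E. e \<subseteq> W}"
      then obtain u v where "u \<noteq> v" "e = {u, v}" using G unfolding simple_graph_def by blast
      then show "\<exists>u v. u \<noteq> v \<and> u \<in> W \<and> v \<in> W \<and> e = {u, v}" using e by blast
    qed
    have "card {e \<in> E. e \<subseteq> W} \<le> 3 * card W + card (meeting_pairs {e \<in> E. e \<subseteq> W} S)"
      by (rule card_edges_le_meeting_pairs[OF sub, of S b]) (use S in auto)
    moreover have "meeting_pairs {e \<in> E. e \<subseteq> W} S \<subseteq> {q \<in> ?X. \<Union>q \<subseteq> W}"
      unfolding meeting_pairs_def by auto
    then have "card (meeting_pairs {e \<in> E. e \<subseteq> W} S) \<le> card {q \<in> ?X. \<Union>q \<subseteq> W}"
      using finX by (intro card_mono) auto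
    moreover have "{v \<in> V. {v} \<subseteq> W} = W" using W by auto
    ultimately have "real (card {e \<in> E. e \<subseteq> W}) \<le>
        3 * real (card {v \<in> V. {v} \<subseteq> W}) + real (card {q \<in> ?X. \<Union>q \<subseteq> W})"
      by simp
    then have "?w W * real (card {e \<in> E. e \<subseteq> W}) \<le>
        ?w W * (3 * real (card {v \<in> V. {v} \<subseteq> W}) + real (card {q \<in> ?X. \<Union>q \<subseteq> W}))"
      using p by (intro mult_left_mono) auto
    then show ?thesis by (simp add: algebra_simps)
  qed
  have "p ^ 2 * m = (\<Sum>W\<in>Pow V. ?w W * real (card {e \<in> E. e \<subseteq> W}))"
    unfolding m_def by (rule sum_random_subset_card[symmetric]) (use D in auto)
  also have "\<dots> \<le> (\<Sum>W\<in>Pow V. 3 * (?w W * real (card {v \<in> V. {v} \<subseteq> W})) +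
      ?w W * real (card {q \<in> ?X. \<Union>q \<subseteq> W}))"
    by (rule sum_mono) (rule step)
  also have "\<dots> = 3 * (\<Sum>W\<in>Pow V. ?w W * real (card {v \<in> V. {v} \<subseteq> W})) +
      (\<Sum>W\<in>Pow V. ?w W * real (card {q \<in> ?X. \<Union>q \<subseteq> W}))"
    by (simp add: sum.distrib sum_distrib_left)
  also have "(\<Sum>W\<in>Pow V. ?w W * real (card {v \<in> V. {v} \<subseteq> W})) = p ^ 1 * n"
    unfolding n_def by (rule sum_random_subset_card) (use D in auto)
  also have "(\<Sum>W\<in>Pow V. ?w W * real (card {q \<in> ?X. \<Union>q \<subseteq> W})) = p ^ 4 * x"
    unfolding x_def
  proof (rule sum_random_subset_card)
    fix q assume "q \<in> ?X"
    then obtain e f where q: "q = {e, f}" "e \<in> E" "f \<in> E" "e \<inter> f = {}"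
      unfolding meeting_pairs_def by blast
    \<comment> \<open>Only disjoint edges are paired, so a pair always has four vertices.\<close>
    moreover have "card (e \<union> f) = card e + card f"
      using q finite_subset[OF D(4) D(1)] by (intro card_Un_disjoint) auto
    ultimately show "\<Union>q \<subseteq> V \<and> card (\<Union>q) = 4" using D(3,4) by auto
  qed (use D finX in auto)
  finally have ineq: "p ^ 2 * m \<le> 3 * (p ^ 1 * n) + p ^ 4 * x" .
  have m0: "m > 0" using n0 mn by linarith
  \<comment> \<open>Multiplication by \<open>m ^ 4\<close> clears the denominators of
    \<open>p\<close>. The coefficients become 16, 12 and 256, and 256 / (16 - 12) is the constant
    64.\<close>
  have "p ^ 2 * m * m ^ 4 \<le> (3 * (p ^ 1 * n) + p ^ 4 * x) * m ^ 4"
    using ineq m0 by (intro mult_right_mono) auto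
  moreover have "p * m = 4 * n" using m0 by (simp add: p_def)
  then have "p ^ 2 * m * m ^ 4 = 16 * n ^ 2 * m ^ 3"
    "(3 * (p ^ 1 * n) + p ^ 4 * x) * m ^ 4 = 12 * n ^ 2 * m ^ 3 + 256 * n ^ 4 * x"
    by algebra+
  ultimately have "n ^ 2 * m ^ 3 \<le> n ^ 2 * (64 * n ^ 2 * x)" by (simp add: algebra_simps)
  then have "m ^ 3 \<le> 64 * n ^ 2 * x" using n0 by simp
  then have "real ((card E) ^ 3) \<le> real (64 * (card V)\<^sup>2 * card ?X)"
    by (simp add: m_def n_def x_def)
  then show ?thesis by (simp only: of_nat_le_iff)
qed

section \<open>Shallow topological minors\<close>

definition path_edges :: "'v list \<Rightarrow> 'v set set" where
  "path_edges P = (\<lambda>i. {P ! i, P ! Suc i}) ` {..<length P - 1}"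

lemma path_edges_Cons_Cons: "path_edges (x # y # ys) = insert {x, y} (path_edges (y # ys))"
proof -
  have "{..<length (x # y # ys) - 1} = insert 0 (Suc ` {..<length (y # ys) - 1})"
    by (simp add: lessThan_Suc_eq_insert_0)
  then show ?thesis unfolding path_edges_def by (simp add: image_image)
qed

lemma path_edges_Cons_Nil [simp]: "path_edges [x] = {}"
  by (simp add: path_edges_def)

lemma card_path_edges: "finite (path_edges P)" "card (path_edges P) \<le> length P - 1"
  unfolding path_edges_def using card_image_le[of "{..<length P - 1}"] by auto

lemma path_edges_subset: "e \<in> path_edges P \<Longrightarrow> e \<subseteq> set P"
  unfolding path_edges_def by auto

text \<open>The sets of consecutive edges share the point of their common vertex, so the union stays
  path-connected.\<close>

lemma path_connected_along_path:
  assumes "2 \<le> length P"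
    and "\<And>e. e \<in> path_edges P \<Longrightarrow> path_connected (C e) \<and> p ` e \<subseteq> C e"
  shows "path_connected (\<Union>e\<in>path_edges P. C e) \<and> p ` set P \<subseteq> (\<Union>e\<in>path_edges P. C e)"
  using assms
proof (induction P rule: induct_list012)
  case (3 x y zs)
  have xy: "path_connected (C {x, y})" "p x \<in> C {x, y}" "p y \<in> C {x, y}"
    using "3.prems"(2)[of "{x, y}"] by (auto simp: path_edges_Cons_Cons)
  show ?case
  proof (cases zs)
    case Nil
    then show ?thesis using xy by (simp add: path_edges_Cons_Cons)
  next
    case (Cons z zs')
    then have IH: "path_connected (\<Union>e\<in>path_edges (y # zs). C e)"
        "p ` set (y # zs) \<subseteq> (\<Union>e\<in>path_edges (y # zs). C e)"
      using "3.IH"(2) "3.prems"(2) by (auto simp: path_edges_Cons_Cons)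
    have "path_connected (C {x, y} \<union> (\<Union>e\<in>path_edges (y # zs). C e))"
      using xy IH by (intro path_connected_Un) auto
    then show ?thesis using xy IH by (auto simp: path_edges_Cons_Cons)
  qed
qed auto

lemma set_path_subset: "set P \<subseteq> {hd P, last P} \<union> path_internal P"
proof (cases P)
  case (Cons x xs)
  have "set xs \<subseteq> insert (last xs) (set (butlast xs))"
    by (cases xs rule: rev_cases) auto
  then show ?thesis using Cons by (auto simp: path_internal_def split: if_splits)
qed simp

section \<open>Crossings in gap-planar drawings\<close>

text \<open>A crossing between two edges of \<open>F\<close> is charged to one of them, hence to an
  edge of \<open>F\<close>. The bound therefore depends on the part of the graph used by the minor
  and not on all of \<open>E\<close>.\<close>

lemma gap_planar_drawing_card_crossings:
  assumes "gap_planar_drawing k V E p \<gamma>" "F \<subseteq> E" "finite F"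
  shows "finite {c \<in> crossings E \<gamma>. snd c \<subseteq> F}" "card {c \<in> crossings E \<gamma>. snd c \<subseteq> F} \<le> k * card F"
proof -
  let ?C = "{c \<in> crossings E \<gamma>. snd c \<subseteq> F}"
  obtain ch where ch: "\<And>c. c \<in> crossings E \<gamma> \<Longrightarrow> ch c \<in> snd c"
    and k: "\<And>e. e \<in> E \<Longrightarrow> finite {c \<in> crossings E \<gamma>. ch c = e} \<and> card {c \<in> crossings E \<gamma>. ch c = e} \<le> k"
    using assms(1) unfolding gap_planar_drawing_def by auto
  let ?D = "\<lambda>e. {c \<in> crossings E \<gamma>. ch c = e}"
  have sub: "?C \<subseteq> (\<Union>e\<in>F. ?D e)" using ch by auto
  have fin: "finite (\<Union>e\<in>F. ?D e)" using k assms(2,3) by blast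
  show "finite ?C" using sub fin by (rule finite_subset)
  have "card ?C \<le> card (\<Union>e\<in>F. ?D e)" using sub fin by (intro card_mono)
  also have "\<dots> \<le> (\<Sum>e\<in>F. card (?D e))" using assms(3) by (rule card_UN_le)
  also have "\<dots> \<le> (\<Sum>e\<in>F. k)" using k assms(2) by (intro sum_mono) auto
  finally show "card ?C \<le> k * card F" by (simp add: mult.commute)
qed

lemma drawing_path_image:
  assumes "drawing V E p \<gamma>" "e \<in> E"
  shows "path_image (\<gamma> e) = curve_interior (\<gamma> e) \<union> p ` e"
proof -
  have "{0..1::real} = insert 0 (insert 1 {0<..<1})" by auto
  then have "path_image (\<gamma> e) = curve_interior (\<gamma> e) \<union> {pathstart (\<gamma> e), pathfinish (\<gamma> e)}"
    unfolding path_image_def curve_interior_def pathstart_def pathfinish_def by auto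
  also have "{pathstart (\<gamma> e), pathfinish (\<gamma> e)} = p ` e"
    using assms unfolding drawing_def by blast
  finally show ?thesis .
qed

text \<open>Vertices are drawn at distinct points and off all edge interiors, so a common point of
  disjoint edges is no end point of either.\<close>

lemma drawing_disjoint_edges_meet:
  assumes dr: "drawing V E p \<gamma>" and ef: "e \<in> E" "f \<in> E" "e \<subseteq> V" "f \<subseteq> V" "e \<inter> f = {}"
    and x: "x \<in> path_image (\<gamma> e)" "x \<in> path_image (\<gamma> f)"
  shows "x \<in> curve_interior (\<gamma> e) \<inter> curve_interior (\<gamma> f)"
proof -
  have int: "p v \<notin> curve_interior (\<gamma> g)" if "v \<in> V" "g \<in> E" for v g
    using dr that by (simp add: drawing_def)
  have "p ` e \<inter> p ` f = {}"
    using dr ef inj_on_image_Int[of p V e f] by (auto simp: drawing_def)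
  then show ?thesis
    using x int ef(1,2) subsetD[OF ef(3)] subsetD[OF ef(4)]
    unfolding drawing_path_image[OF dr ef(1)] drawing_path_image[OF dr ef(2)] by blast
qed

section \<open>The edge bound for a single minor\<close>

lemma shallow_top_minor_card_edges:
  assumes G: "simple_graph V E" and gap: "gap_planar_drawing k V E p \<gamma>"
    and H: "simple_graph HV HE" and minor: "shallow_top_minor r HV HE V E"
  shows "real (card HE) \<le> 8 * sqrt (real ((2 * r + 1) * (k + 1))) * real (card HV)"
proof -
  have dr: "drawing V E p \<gamma>" using gap by (simp add: gap_planar_drawing_def)
  note DG = simple_graphD[OF G] and DH = simple_graphD[OF H]
  obtain \<phi> P where minor': "inj_on \<phi> HV \<and> \<phi> ` HV \<subseteq> V \<and>
      (\<forall>e\<in>HE. graph_path V E (P e) \<and> {hd (P e), last (P e)} = \<phi> ` e \<and>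
         length (P e) \<le> 2 * r + 2 \<and> path_internal (P e) \<inter> \<phi> ` HV = {}) \<and>
      (\<forall>e\<in>HE. \<forall>f\<in>HE. e \<noteq> f \<longrightarrow> path_internal (P e) \<inter> path_internal (P f) = {})"
    using minor unfolding shallow_top_minor_def by (elim exE)
  have phi: "inj_on \<phi> HV" "\<phi> ` HV \<subseteq> V"
    and P: "\<And>h. h \<in> HE \<Longrightarrow> graph_path V E (P h) \<and> {hd (P h), last (P h)} = \<phi> ` h \<and>
        length (P h) \<le> 2 * r + 2 \<and> path_internal (P h) \<inter> \<phi> ` HV = {}"
    and internal: "\<And>h h'. h \<in> HE \<Longrightarrow> h' \<in> HE \<Longrightarrow> h \<noteq> h' \<Longrightarrow> path_internal (P h) \<inter> path_internal (P h') = {}"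
    using minor' by simp_all
  have PE: "path_edges (P h) \<subseteq> E" if "h \<in> HE" for h
    using P[OF that] unfolding graph_path_def path_edges_def by auto
  \<comment> \<open>Internal vertices lie on one path only and are not branch vertices, so two paths
    can share only the images of common end vertices.\<close>
  have common: "set (P h) \<inter> set (P h') \<subseteq> \<phi> ` (h \<inter> h')" if "h \<in> HE" "h' \<in> HE" "h \<noteq> h'" for h h'
  proof -
    have disjoint_union: "A \<inter> A' \<subseteq> X \<inter> X'"
      if "A \<subseteq> X \<union> I" "A' \<subseteq> X' \<union> I'" "X \<subseteq> B" "X' \<subseteq> B" "I \<inter> B = {}" "I' \<inter> B = {}" "I \<inter> I' = {}"
      for A A' X X' I I' B :: "'v set"
      using that by blast
    have "set (P h) \<inter> set (P h') \<subseteq> \<phi> ` h \<inter> \<phi> ` h'"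
    proof (rule disjoint_union)
      show "set (P h) \<subseteq> \<phi> ` h \<union> path_internal (P h)" "set (P h') \<subseteq> \<phi> ` h' \<union> path_internal (P h')"
        using set_path_subset[of "P h"] set_path_subset[of "P h'"] P that by auto
      show "\<phi> ` h \<subseteq> \<phi> ` HV" "\<phi> ` h' \<subseteq> \<phi> ` HV" using DH(4) that by auto
    qed (use P internal that in simp_all)
    also have "\<phi> ` h \<inter> \<phi> ` h' = \<phi> ` (h \<inter> h')"
      using DH(4) that phi(1) by (intro inj_on_image_Int[symmetric]) auto
    finally show ?thesis .
  qed
  \<comment> \<open>By \<open>common\<close>, a shared edge would have both its ends in the image of
    \<open>h \<inter> h'\<close>; two common ends force \<open>h = h'\<close>.\<close>
  have edge_disjoint: "h = h'" if h: "h \<in> HE" "h' \<in> HE" and e: "e \<in> path_edges (P h)" "e \<in> path_edges (P h')" for h h' e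
  proof (rule ccontr)
    assume ne: "h \<noteq> h'"
    have fin: "finite h" "finite h'" using h finite_subset[OF DH(4) DH(1)] by auto
    have "e \<subseteq> \<phi> ` (h \<inter> h')"
      using common[OF h ne] path_edges_subset[OF e(1)] path_edges_subset[OF e(2)] by blast
    then have "card e \<le> card (h \<inter> h')"
      using fin by (meson card_image_le card_mono finite_Int finite_imageI le_trans)
    moreover have "card e = 2" using DG(3) PE[OF h(1)] e(1) by auto
    ultimately have "2 \<le> card (h \<inter> h')" by simp
    then have "card h \<le> card (h \<inter> h')" "card h' \<le> card (h \<inter> h')"
      using DH(3) h by simp_all
    then have "h \<inter> h' = h" "h \<inter> h' = h'"
      using fin by (intro card_seteq Int_lower1 Int_lower2; simp)+
    then show False using ne by simp
  qed
  define b where "b = p \<circ> \<phi>"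
  define S where "S h = (\<Union>e\<in>path_edges (P h). path_image (\<gamma> e))" for h
  define F where "F = (\<Union>h\<in>HE. path_edges (P h))"
  have S: "path_connected (S h) \<and> b ` h \<subseteq> S h" if h: "h \<in> HE" for h
  proof -
    have "path_connected (S h) \<and> p ` set (P h) \<subseteq> S h"
      unfolding S_def
    proof (rule path_connected_along_path)
      show "2 \<le> length (P h)" using P[OF h] by (simp add: graph_path_def)
      fix e assume "e \<in> path_edges (P h)"
      then have e: "e \<in> E" using PE[OF h] by auto
      then have "arc (\<gamma> e)" using dr by (simp add: drawing_def)
      then have "path_connected (path_image (\<gamma> e))"
        by (intro path_connected_path_image arc_imp_path)
      then show "path_connected (path_image (\<gamma> e)) \<and> p ` e \<subseteq> path_image (\<gamma> e)"
        using drawing_path_image[OF dr e] by blast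
    qed
    moreover have "P h \<noteq> []" using P[OF h] by (auto simp: graph_path_def)
    then have "{hd (P h), last (P h)} \<subseteq> set (P h)" by simp
    then have "\<phi> ` h \<subseteq> set (P h)" using P[OF h] by simp
    ultimately show ?thesis unfolding b_def image_comp[symmetric] by blast
  qed
  have F: "F \<subseteq> E" "finite F" using PE DH(2) by (auto simp: F_def card_path_edges)
  have "card F \<le> (\<Sum>h\<in>HE. card (path_edges (P h)))"
    unfolding F_def using DH(2) by (rule card_UN_le)
  \<comment> \<open>At most \<open>2 * r + 2\<close> vertices on a path leave at most
    \<open>2 * r + 1\<close> edges.\<close>
  also have "\<dots> \<le> (\<Sum>h\<in>HE. 2 * r + 1)"
  proof (rule sum_mono)
    fix h assume "h \<in> HE"
    then show "card (path_edges (P h)) \<le> 2 * r + 1" using card_path_edges(2)[of "P h"] P[of h] by auto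
  qed
  finally have cardF: "card F \<le> (2 * r + 1) * card HE" by (simp add: mult.commute)
  define C where "C = {c \<in> crossings E \<gamma>. snd c \<subseteq> F}"
  \<comment> \<open>The edge of the minor whose path uses \<open>e\<close>; it is unique by
    \<open>edge_disjoint\<close>.\<close>
  define own where "own e = (SOME h. h \<in> HE \<and> e \<in> path_edges (P h))" for e
  have own: "own e = h" if "h \<in> HE" "e \<in> path_edges (P h)" for e h
    unfolding own_def using that edge_disjoint by (intro some_equality) auto
  \<comment> \<open>Disjoint edges of the minor have vertex-disjoint paths, so a common point of
    their sets is a crossing in the given drawing. Sending a crossing to the owners of its two edges
    thus reaches every meeting pair.\<close>
  have "meeting_pairs HE S \<subseteq> (\<lambda>c. own ` snd c) ` C"
  proof
    fix q assume "q \<in> meeting_pairs HE S"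
    then obtain h h' where q: "q = {h, h'}" and h: "h \<in> HE" "h' \<in> HE" "h \<inter> h' = {}" and "S h \<inter> S h' \<noteq> {}"
      unfolding meeting_pairs_def by blast
    then obtain x e e' where e: "e \<in> path_edges (P h)" "e' \<in> path_edges (P h')"
      and x: "x \<in> path_image (\<gamma> e)" "x \<in> path_image (\<gamma> e')"
      unfolding S_def by blast
    have eE: "e \<in> E" "e' \<in> E" using e h PE by auto
    have "h \<noteq> h'" using h DH(3)[of h] by auto
    then have "e \<inter> e' = {}"
      using common[OF h(1,2)] h(3) path_edges_subset[OF e(1)] path_edges_subset[OF e(2)] by auto
    then have "x \<in> curve_interior (\<gamma> e) \<inter> curve_interior (\<gamma> e')"
      using DG(4) eE x by (intro drawing_disjoint_edges_meet[OF dr]) auto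
    moreover have "e \<noteq> e'" using \<open>e \<inter> e' = {}\<close> DG(3)[OF eE(1)] by auto
    ultimately have "(x, {e, e'}) \<in> crossings E \<gamma>"
      using eE unfolding crossings_def by blast
    moreover have "{e, e'} \<subseteq> F" using e h by (auto simp: F_def)
    ultimately have "(x, {e, e'}) \<in> C" by (simp add: C_def)
    moreover have "q = own ` snd (x, {e, e'})" using own e h q by auto
    ultimately show "q \<in> (\<lambda>c. own ` snd c) ` C" by (rule rev_image_eqI)
  qed
  moreover have "finite C" and C: "card C \<le> k * card F"
    using gap_planar_drawing_card_crossings[OF gap F] by (simp_all add: C_def)
  ultimately have "card (meeting_pairs HE S) \<le> card C"
    by (meson surj_card_le)
  also have "\<dots> \<le> k * ((2 * r + 1) * card HE)"
    using C cardF by (meson le_trans mult_le_mono2)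
  finally have X: "card (meeting_pairs HE S) \<le> k * ((2 * r + 1) * card HE)" .
  define n m where "n = real (card HV)" and "m = real (card HE)"
  define a where "a = real ((2 * r + 1) * (k + 1))"
  have "1 \<le> a" unfolding a_def real_of_nat_ge_one_iff by simp
  have n0: "0 \<le> n" by (simp add: n_def)
  have "m \<le> 8 * sqrt a * n"
  \<comment> \<open>The crossing lemma covers only the dense case; in the sparse one
    \<open>4 * n\<close> is enough, because \<open>1 \<le> a\<close>.\<close>
  proof (cases "4 * card HV \<le> card HE")
    case False
    then have "m \<le> 4 * n" unfolding m_def n_def by linarith
    also have "\<dots> \<le> 8 * sqrt a * n"
    proof (rule mult_right_mono)
      have "1 \<le> sqrt a" using \<open>1 \<le> a\<close> by simp
      then show "4 \<le> 8 * sqrt a" by linarith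
    qed (rule n0)
    finally show ?thesis .
  next
    case True
    show ?thesis
    proof (cases "card HE = 0")
      case False
      have "(card HE) ^ 3 \<le> 64 * (card HV)\<^sup>2 * (k * ((2 * r + 1) * card HE))"
        using crossing_lemma[OF H S True] X by (meson le_trans mult_le_mono2)
      \<comment> \<open>Passing from \<open>k\<close> to \<open>k + 1\<close> brings in
        \<open>a\<close>; then one factor \<open>card HE\<close> cancels and a square root
        finishes.\<close>
      also have "\<dots> \<le> 64 * (card HV)\<^sup>2 * ((k + 1) * ((2 * r + 1) * card HE))"
        by (intro mult_le_mono2 mult_le_mono1) simp
      also have "\<dots> = card HE * (64 * (card HV)\<^sup>2 * ((2 * r + 1) * (k + 1)))"
        by (simp only: mult_ac)
      finally have "(card HE)\<^sup>2 \<le> 64 * (card HV)\<^sup>2 * ((2 * r + 1) * (k + 1))"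
        using False by (simp add: power3_eq_cube power2_eq_square mult.assoc)
      then have "real ((card HE)\<^sup>2) \<le> real (64 * (card HV)\<^sup>2 * ((2 * r + 1) * (k + 1)))"
        by (simp only: of_nat_le_iff)
      then have "m\<^sup>2 \<le> 64 * n\<^sup>2 * a" by (simp only: m_def n_def a_def of_nat_mult of_nat_power of_nat_numeral)
      also have "\<dots> = (8 * sqrt a * n)\<^sup>2"
        using \<open>1 \<le> a\<close> by (simp add: power_mult_distrib)
      finally show ?thesis
        by (rule power2_le_imp_le) (use n0 \<open>1 \<le> a\<close> in simp)
    qed (use n0 \<open>1 \<le> a\<close> m_def in simp)
  qed
  then show ?thesis by (simp only: m_def n_def a_def)
qed

section \<open>The supremum over all minors\<close>

theorem theorem2:
  fixes V :: "'v set" and E :: "'v set set" and k r :: nat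
  assumes "simple_graph V E"
    and "gap_planar k V E"
  shows "top_grad r V E \<le> 8 * sqrt (real ((2 * r + 1) * (k + 1)))"
proof -
  obtain p \<gamma> where gap: "gap_planar_drawing k V E p \<gamma>"
    using assms(2) by (auto simp: gap_planar_def)
  show ?thesis
    unfolding top_grad_def
  proof (rule cSup_least)
    \<comment> \<open>The empty graph is always a minor, so the \<open>Sup\<close> is taken over a
      nonempty set and any upper bound dominates it.\<close>
    have "simple_graph ({} :: nat set) {}" "shallow_top_minor r ({} :: nat set) {} V E"
      by (auto simp: simple_graph_def shallow_top_minor_def)
    then show "{density HV HE | (HV :: nat set) HE. simple_graph HV HE \<and> shallow_top_minor r HV HE V E} \<noteq> {}"
      by blast
  next
    fix d assume "d \<in> {density HV HE | (HV :: nat set) HE. simple_graph HV HE \<and> shallow_top_minor r HV HE V E}"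
    then obtain HV :: "nat set" and HE where d: "d = density HV HE"
      and H: "simple_graph HV HE" "shallow_top_minor r HV HE V E" by blast
    show "d \<le> 8 * sqrt (real ((2 * r + 1) * (k + 1)))"
    \<comment> \<open>The density of the empty graph is 0 by convention, so only a nonempty
      \<open>HV\<close> requires the edge bound.\<close>
    proof (cases "HV = {}")
      case False
      then have "0 < real (card HV)" using simple_graphD(1)[OF H(1)] by (simp add: card_gt_0_iff)
      then show ?thesis
        using shallow_top_minor_card_edges[OF assms(1) gap H] False
        unfolding d density_def by (simp only: if_False pos_divide_le_eq)
    qed (simp add: d density_def)
  qed
qed

end
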